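(* Let $n$ be a positive integer. Let $\alpha,\gamma>0$ be real and $0<\mu\leqq 1$, and suppose that $$\alpha=\beta+\frac{2}{\pi}\arctan(n\beta),\qquad \beta=\gamma+\frac{2}{\pi}\arctan(n\gamma),\qquad \frac{\pi}{2}(\alpha+\gamma)\leqq\phi(\mu),$$ where $$\phi(\mu)=\frac{\pi}{2}(\mu+1)-\arctan\frac{\cos\frac{\mu\pi}{2}}{\sin\frac{\mu\pi}{2}+\frac{n\mu}{1-\mu}\left(\frac{1-\mu}{1+\mu}\right)^{\frac{1+\mu}{2}}}.$$ If $f(z)\in\mathcal{A}_n$ satisfies $$|\arg(f'(z))|<\frac{\pi}{2}\alpha\qquad(z\in\mathbb{U}),$$ then the function $F(z)=\int_0^z\frac{f(t)}{t}\,dt$ $(z\in\mathbb{U})$ belongs to $\mathcal{STS}(\mu)$, i.e. $\left|\arg\left(\frac{zF'(z)}{F(z)}\right)\right|<\frac{\pi}{2}\mu$ for all $z\in\mathbb{U}$.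
   Context: $\mathbb{U}=\{z\in\mathbb{C}:|z|<1\}$. For a positive integer $n$, $\mathcal{A}_n$ is the class of functions $f(z)=z+a_{n+1}z^{n+1}+a_{n+2}z^{n+2}+\cdots$ analytic in $\mathbb{U}$. For $0<\mu\leqq1$, $\mathcal{STS}(\mu)=\{f\in\mathcal{A}_n:\left|\arg\left(\frac{zf'(z)}{f(z)}\right)\right|<\frac{\pi}{2}\mu \text{ for } z\in\mathbb{U}\}$. $\arg$ denotes the principal argument. *)

theory Defs
  imports "HOL-Complex_Analysis.Complex_Analysis"
begin

definition class_A :: "nat \<Rightarrow> (complex \<Rightarrow> complex) \<Rightarrow> bool" where
  "class_A n f \<longleftrightarrow> f holomorphic_on ball 0 1 \<and> f 0 = 0 \<and> deriv f 0 = 1 \<and>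
     (\<forall>k. 2 \<le> k \<and> k \<le> n \<longrightarrow> (deriv ^^ k) f 0 = 0)"

text \<open>STS(mu), with the quotient z F'(z)/F(z) required to be a nonzero finite number
(so that its argument is defined) at every z \<noteq> 0 of the disc; at z = 0 the
quotient is understood as its limit 1.\<close>
definition STS :: "nat \<Rightarrow> real \<Rightarrow> (complex \<Rightarrow> complex) \<Rightarrow> bool" where
  "STS n \<mu> F \<longleftrightarrow> class_A n F \<and>
     (\<forall>z\<in>ball 0 1 - {0}. z * deriv F z / F z \<noteq> 0 \<and>
        \<bar>Arg (z * deriv F z / F z)\<bar> < pi / 2 * \<mu>)"

definition phi :: "nat \<Rightarrow> real \<Rightarrow> real" where
  "phi n \<mu> = pi / 2 * (\<mu> + 1) -
     arctan (cos (\<mu> * pi / 2) /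
       (sin (\<mu> * pi / 2) + real n * \<mu> / (1 - \<mu>) * ((1 - \<mu>) / (1 + \<mu>)) powr ((1 + \<mu>) / 2)))"

end

theory Submission
  imports Defs "HOL-Real_Asymp.Real_Asymp"
begin

text \<open>With \<open>p = f / z\<close>, \<open>P = F / z\<close> and \<open>q = p / P = z F' / F\<close> we have \<open>f' = p + z p'\<close>,
  \<open>p = P + z P'\<close> and \<open>f' = P q (q + z q' / q)\<close>. If one of these functions
  \<open>p = 1 + O(z\<^sup>n)\<close> leaves a sector around the positive axis of half-angle \<open>\<pi>\<beta>/2\<close>, then at a first
  exit point \<open>z0\<close> its logarithmic derivative satisfies \<open>z p' / p = \<plusminus>\<i>\<kappa>\<close> with
  \<open>\<kappa> \<ge> n\<beta> (a + 1/a) / 2\<close> and \<open>a = \<bar>p z0\<bar>\<^bsup>1/\<beta>\<^esup>\<close>: this is the Schwarz lemma at the boundary for the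
  function \<open>p\<^bsup>1/\<beta>\<^esup>\<close> with values in the right half-plane. At such a point \<open>f'\<close>, respectively \<open>p\<close>, has too
  large an argument; applied to \<open>p\<close>, \<open>P\<close> and \<open>q\<close> in turn this confines their arguments to
  \<open>\<pi>\<beta>/2\<close>, \<open>\<pi>\<gamma>/2\<close> and \<open>\<pi>\<mu>/2\<close>. The hypotheses force \<open>2\<beta> < \<alpha> + \<gamma> \<le> 2\<close>, so all sectors stay in
  the right half-plane and no branch problems arise.\<close>

section \<open>Schwarz lemma for zeros of order n, in the disc and at a boundary point\<close>

text \<open>The singularity of \<open>w z / z ^ n\<close> at 0 is removable. The maximum principle
  on \<open>cball 0 \<rho>\<close> with \<rho> < r bounds the extension by
  \<open>1 / \<rho> ^ n\<close>, and then \<rho> tends to r. Expressing the order of vanishing by a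
  big-O lets it pass easily through composition and quotients.\<close>

lemma Schwarz_order:
  assumes hol: "w holomorphic_on ball 0 r" and bd: "\<And>z. z \<in> ball 0 r \<Longrightarrow> norm (w z) \<le> 1"
    and ord: "w \<in> O[at 0](\<lambda>z. z ^ n)" and z: "z \<in> ball 0 r" "z \<noteq> 0"
  shows "norm (w z) \<le> (norm z / r) ^ n"
proof -
  have r: "norm z < r" "0 < r" "0 < norm z" using z by (auto intro: le_less_trans[OF norm_ge_zero])
  from ord obtain c where c: "\<forall>\<^sub>F z in at 0. norm (w z) \<le> c * norm (z ^ n)"
    by (auto elim!: landau_o.bigE)
  have "\<forall>\<^sub>F z in at 0. norm (w z / z ^ n) \<le> c"
    using c eventually_neq_at_within[of 0 0 UNIV]
    by eventually_elim (simp add: norm_divide divide_simps)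
  moreover have "(\<lambda>z. w z / z ^ n) holomorphic_on ball 0 r - {0}"
    by (intro holomorphic_intros holomorphic_on_subset[OF hol]) auto
  ultimately obtain g where g: "g holomorphic_on ball 0 r" "\<And>z. z \<in> ball 0 r - {0} \<Longrightarrow> g z = w z / z ^ n"
    using holomorphic_on_extend_bounded[of "\<lambda>z. w z / z ^ n" "ball 0 r" 0] r by auto
  have *: "norm (w z) \<le> (norm z / \<rho>) ^ n" if \<rho>: "norm z < \<rho>" "\<rho> < r" for \<rho>
  proof -
    have "norm (g z) \<le> 1 / \<rho> ^ n"
    proof (rule maximum_modulus_frontier[of g "cball 0 \<rho>"])
      show "g holomorphic_on interior (cball 0 \<rho>)"
        by (rule holomorphic_on_subset[OF g(1)]) (use \<rho> in auto)
      show "continuous_on (closure (cball 0 \<rho>)) g"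
        by (rule holomorphic_on_imp_continuous_on, rule holomorphic_on_subset[OF g(1)]) (use \<rho> in auto)
      show "norm (g x) \<le> 1 / \<rho> ^ n" if "x \<in> frontier (cball 0 \<rho>)" for x
      proof -
        have x: "norm x = \<rho>" "x \<in> ball 0 r - {0}" using that \<rho> r(3) by (auto simp: frontier_cball)
        then show ?thesis using g(2)[OF x(2)] bd[of x] zero_less_norm_iff[of x]
          by (auto simp: norm_divide norm_power intro!: divide_right_mono)
      qed
    qed (use \<rho> in auto)
    moreover have "norm (g z) = norm (w z) / norm z ^ n"
      using g(2)[of z] z by (simp add: norm_divide norm_power)
    moreover have "0 < \<rho>" using r(3) \<rho> by linarith
    ultimately show ?thesis using r(3) by (simp add: field_simps power_divide)
  qed
  show ?thesis
  proof (rule tendsto_lowerbound)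
    show "((\<lambda>\<rho>. (norm z / \<rho>) ^ n) \<longlongrightarrow> (norm z / r) ^ n) (at_left r)"
      using r by (intro tendsto_intros) auto
    show "\<forall>\<^sub>F \<rho> in at_left r. norm (w z) \<le> (norm z / \<rho>) ^ n"
      using r(1) * by (auto simp: eventually_at_left)
  qed auto
qed

text \<open>The Cayley transform \<open>(h - 1) / (h + 1)\<close> carries the right half-plane into
  the unit disc and turns contact of order n with 1 into a zero of order n.\<close>

lemma Schwarz_halfplane:
  assumes hol: "h holomorphic_on ball 0 r" and pos: "\<And>z. z \<in> ball 0 r \<Longrightarrow> Re (h z) > 0"
    and ord: "(\<lambda>z. h z - 1) \<in> O[at 0](\<lambda>z. z ^ n)" and z: "z \<in> ball 0 r" "z \<noteq> 0"
  shows "norm (h z - 1) \<le> (norm z / r) ^ n * norm (h z + 1)"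
proof -
  have r: "r > 0" using z by (auto intro: le_less_trans[OF norm_ge_zero])
  have ge: "norm (h z + 1) \<ge> 1" if "z \<in> ball 0 r" for z
    using pos[OF that] complex_Re_le_cmod[of "h z + 1"] by simp
  have ne: "h z + 1 \<noteq> 0" if "z \<in> ball 0 r" for z
    using ge[OF that] by (metis norm_zero not_one_le_zero)
  have "norm ((h z - 1) / (h z + 1)) \<le> (norm z / r) ^ n"
  proof (rule Schwarz_order[where w = "\<lambda>z. (h z - 1) / (h z + 1)", OF _ _ _ z])
    show "(\<lambda>z. (h z - 1) / (h z + 1)) holomorphic_on ball 0 r"
      by (intro holomorphic_intros hol) (use ne in auto)
    show "norm ((h x - 1) / (h x + 1)) \<le> 1" if "x \<in> ball 0 r" for x
    proof -
      have "norm (h x - 1) ^ 2 \<le> norm (h x + 1) ^ 2"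
        unfolding cmod_power2 using pos[OF that] by (simp add: power2_eq_square algebra_simps)
      then have "norm (h x - 1) \<le> norm (h x + 1)" by (rule power2_le_imp_le) simp
      then show ?thesis unfolding norm_divide using ne[OF that] by (intro divide_le_eq_1_pos[THEN iffD2]) auto
    qed
    have "\<forall>\<^sub>F z in at 0. z \<in> ball 0 r"
      using r by (intro eventually_at_in_open') auto
    then have "\<forall>\<^sub>F z in at 0. norm ((h z - 1) / (h z + 1)) \<le> norm (h z - 1)"
    proof eventually_elim
      case (elim z)
      show ?case
        using ge[OF elim] ne[OF elim] divide_left_mono[of 1 "norm (h z + 1)" "norm (h z - 1)"]
        by (simp add: norm_divide)
    qed
    then have "(\<lambda>z. (h z - 1) / (h z + 1)) \<in> O[at 0](\<lambda>z. h z - 1)"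
      by (intro landau_o.bigI[of 1]) auto
    then show "(\<lambda>z. (h z - 1) / (h z + 1)) \<in> O[at 0](\<lambda>z. z ^ n)"
      using ord by (rule landau_o.big_trans)
  qed
  then show ?thesis unfolding norm_divide using ne[OF z(1)] by (subst (asm) pos_divide_le_eq) auto
qed

text \<open>Along the circle through \<open>z0\<close>, \<open>Re h\<close> has its minimum 0 at
  \<open>z0\<close>, so \<open>z0 * deriv h z0\<close> is real. Along the radius the Schwarz
  inequality becomes an equality at \<open>z0\<close>, and comparing derivatives there gives the
  bound. An open set \<open>S\<close> replaces a neighbourhood of the closed disc because the
  intended h, a branch of \<open>p\<close> to the power 1/\<beta>, may fail to be holomorphic at
  other points of the circle.\<close>

lemma halfplane_boundary_derivative:
  assumes hol: "h holomorphic_on S" and "open S" and sub: "ball 0 (norm z0) \<subseteq> S" and z0: "z0 \<in> S" "z0 \<noteq> 0"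
    and pos: "\<And>z. z \<in> ball 0 (norm z0) \<Longrightarrow> Re (h z) > 0" and "Re (h z0) = 0"
    and ord: "(\<lambda>z. h z - 1) \<in> O[at 0](\<lambda>z. z ^ n)"
  obtains \<rho> where "z0 * deriv h z0 = - of_real \<rho>" "\<rho> \<ge> n * (1 + (norm (h z0))\<^sup>2) / 2"
proof -
  let ?D = "z0 * deriv h z0"
  have dh: "(h has_field_derivative deriv h z0) (at z0)"
    using hol \<open>open S\<close> z0 by (simp add: holomorphic_derivI)
  have cont: "isCont h x" if "x \<in> S" for x
    using hol \<open>open S\<close> that by (meson continuous_on_eq_continuous_at holomorphic_on_imp_continuous_on)
  have nonneg: "Re (h x) \<ge> 0" if x: "x \<in> S" "norm x = norm z0" for x
  proof (rule tendsto_lowerbound)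
    have "isCont (\<lambda>s. Re (h (of_real s * x))) (1::real)"
      by (rule isCont_o2[where f="\<lambda>s. of_real s * x" and g = "\<lambda>z. Re (h z)"])
        (use cont[OF x(1)] in \<open>auto intro!: continuous_intros\<close>)
    then show "((\<lambda>s. Re (h (of_real s * x))) \<longlongrightarrow> Re (h x)) (at_left (1::real))"
      by (simp add: isCont_def filterlim_at_split)
    show "\<forall>\<^sub>F s in at_left (1::real). 0 \<le> Re (h (of_real s * x))"
      unfolding eventually_at_left_field
      by (rule exI[of _ 0]) (use x z0 pos in \<open>auto simp: norm_mult intro!: less_imp_le\<close>)
  qed auto
  \<comment> \<open>The left side is the derivative at t = 0 of \<open>Re (h (z0 * cis t))\<close>,
    which has a local minimum there.\<close>
  have "Re (\<i> * ?D) = 0"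
  proof -
    have "((\<lambda>t. \<i> * complex_of_real t) has_vector_derivative \<i> * 1) (at 0)"
      by (intro has_vector_derivative_mult_right) (auto intro!: derivative_eq_intros)
    then have dexp: "((\<lambda>t. exp (\<i> * complex_of_real t)) has_vector_derivative \<i>) (at 0)"
      using field_vector_diff_chain_at[of "\<lambda>t. \<i> * complex_of_real t" \<i> 0 exp 1] DERIV_exp[of 0]
      by (simp add: o_def)
    have "((\<lambda>t. z0 * cis t) has_vector_derivative z0 * \<i>) (at 0)"
      using has_vector_derivative_mult_right[OF dexp, of z0] by (simp add: cis_conv_exp)
    then have "((\<lambda>t. h (z0 * cis t)) has_vector_derivative (z0 * \<i> * deriv h z0)) (at 0)"
      using field_vector_diff_chain_at[of "\<lambda>t. z0 * cis t" "z0 * \<i>" 0 h "deriv h z0"] dh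
      by (simp add: o_def)
    then have "((\<lambda>t. Re (h (z0 * cis t))) has_real_derivative Re (\<i> * ?D)) (at 0)"
      unfolding has_real_derivative_iff_has_vector_derivative
      by (rule bounded_linear.has_vector_derivative[OF bounded_linear_Re, THEN has_vector_derivative_eq_rhs]) (simp add: mult_ac)
    moreover obtain d where d: "d > 0" "\<And>t. \<bar>t\<bar> < d \<Longrightarrow> z0 * cis t \<in> S"
    proof -
      have "open ((\<lambda>t. z0 * cis t) -` S)"
        using \<open>open S\<close> by (intro open_vimage) (auto intro!: continuous_intros)
      moreover have "0 \<in> (\<lambda>t. z0 * cis t) -` S" using z0 by simp
      ultimately obtain d where "d > 0" "ball 0 d \<subseteq> (\<lambda>t. z0 * cis t) -` S"
        by (rule openE)
      then show ?thesis by (intro that[of d]) (auto simp: subset_iff dist_norm)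
    qed
    ultimately show ?thesis
      by (elim DERIV_local_min) (use nonneg \<open>Re (h z0) = 0\<close> d(2) in \<open>auto simp: norm_mult\<close>)
  qed
  then have im: "Im ?D = 0" by simp
  let ?H = "\<lambda>s::real. h (of_real s * z0)"
  \<comment> \<open>Since \<open>|h + 1|^2 - |h - 1|^2 = 4 * Re h\<close>, this is
    \<open>s ^ (2*n) * |h + 1|^2 - |h - 1|^2\<close> at the point \<open>s * z0\<close>: the squared
    Schwarz inequality. It is nonnegative for 0 < s < 1 and vanishes at s = 1, so its derivative
    \<open>?l\<close> at 1 cannot be positive.\<close>
  let ?\<phi> = "\<lambda>s. 4 * Re (?H s) - (1 - s ^ (2*n)) * ((Re (?H s) + 1)\<^sup>2 + (Im (?H s))\<^sup>2)"
  have vd: "(?H has_vector_derivative ?D) (at 1)"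
    by (rule field_vector_diff_chain_at[unfolded o_def, where f = "\<lambda>s. of_real s * z0" and g = h])
      (auto intro!: derivative_eq_intros dh)
  have dRe: "((\<lambda>s. Re (?H s)) has_real_derivative Re ?D) (at 1)"
    unfolding has_real_derivative_iff_has_vector_derivative
    by (rule bounded_linear.has_vector_derivative[OF bounded_linear_Re vd])
  have dIm: "((\<lambda>s. Im (?H s)) has_real_derivative Im ?D) (at 1)"
    unfolding has_real_derivative_iff_has_vector_derivative
    by (rule bounded_linear.has_vector_derivative[OF bounded_linear_Im vd])
  let ?l = "4 * Re ?D + 2 * n * (1 + (norm (h z0))\<^sup>2)"
  have "(?\<phi> has_real_derivative ?l) (at 1)"
    by (rule derivative_eq_intros dRe dIm refl)+
      (use \<open>Re (h z0) = 0\<close> in \<open>auto simp: cmod_power2\<close>)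
  have "?l \<le> 0"
  proof (rule ccontr)
    assume "\<not> ?l \<le> 0"
    then obtain d where d: "d > 0" "\<And>\<epsilon>. \<lbrakk>\<epsilon> > 0; \<epsilon> < d\<rbrakk> \<Longrightarrow> ?\<phi> (1 - \<epsilon>) < ?\<phi> 1"
      using DERIV_pos_inc_left[OF \<open>(?\<phi> has_real_derivative ?l) (at 1)\<close>] by auto
    define s where "s = 1 - min d 1 / 2"
    have s: "0 < s" "s < 1" using d(1) by (auto simp: s_def)
    have "?\<phi> s < ?\<phi> 1" using d(2)[of "1 - s"] d(1) by (auto simp: s_def)
    moreover have "?\<phi> 1 = 0" using \<open>Re (h z0) = 0\<close> by simp
    moreover have "?\<phi> s \<ge> 0"
    proof -
      have b: "of_real s * z0 \<in> ball 0 (norm z0)" using s z0 by (simp add: norm_mult)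
      have "norm (?H s - 1) \<le> (norm (of_real s * z0) / norm z0) ^ n * norm (?H s + 1)"
        by (rule Schwarz_halfplane) (use hol sub holomorphic_on_subset pos ord b s z0 in auto)
      then have "norm (?H s - 1) \<le> s ^ n * norm (?H s + 1)"
        using s z0 by (simp add: norm_mult)
      then have "norm (?H s - 1) ^ 2 \<le> (s ^ n * norm (?H s + 1)) ^ 2"
        by (intro power_mono) auto
      also have "\<dots> = s ^ (2*n) * norm (?H s + 1) ^ 2"
        by (simp add: power_mult_distrib power_mult[symmetric] mult.commute)
      finally show ?thesis by (simp add: cmod_power2) (simp add: power2_eq_square algebra_simps)
    qed
    ultimately show False by linarith
  qed
  show ?thesis
  proof (rule that[of "- Re ?D"])
    show "?D = - of_real (- Re ?D)" using im by (simp add: complex_eq_iff)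
    show "- Re ?D \<ge> n * (1 + (norm (h z0))\<^sup>2) / 2"
      using \<open>?l \<le> 0\<close> by (simp add: field_simps)
  qed
qed

section \<open>Transfer of contact order, and rates of decay at a zero\<close>

text \<open>Differentiability at c gives a Lipschitz estimate against the fixed point c. It carries
  the order of contact with 1 from \<open>p\<close> to its power 1/\<beta>, and yields linear decay
  along a radius towards a zero.\<close>

lemma bigo_diff_compose:
  fixes \<Psi> :: "complex \<Rightarrow> complex" and p g :: "'a \<Rightarrow> complex"
  assumes der: "(\<Psi> has_field_derivative D) (at c)" and lim: "(p \<longlongrightarrow> c) F"
    and ord: "(\<lambda>z. p z - c) \<in> O[F](g)"
  shows "(\<lambda>z. \<Psi> (p z) - \<Psi> c) \<in> O[F](g)"
proof -
  have "((\<lambda>w. norm ((\<Psi> w - \<Psi> c) / (w - c))) \<longlongrightarrow> norm D) (at c)"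
    using der unfolding has_field_derivative_iff by (rule tendsto_norm)
  then have "\<forall>\<^sub>F w in at c. norm ((\<Psi> w - \<Psi> c) / (w - c)) < norm D + 1"
    by (rule order_tendstoD) simp
  then have "\<forall>\<^sub>F w in nhds c. norm (\<Psi> w - \<Psi> c) \<le> (norm D + 1) * norm (w - c)"
    unfolding eventually_at_filter
    by eventually_elim (auto simp: norm_divide divide_simps split: if_splits)
  then have "\<forall>\<^sub>F z in F. norm (\<Psi> (p z) - \<Psi> c) \<le> (norm D + 1) * norm (p z - c)"
    using lim by (rule eventually_compose_filterlim)
  then have "(\<lambda>z. \<Psi> (p z) - \<Psi> c) \<in> O[F](\<lambda>z. p z - c)"
    by (rule landau_o.bigI[rotated]) (simp add: add_nonneg_pos)
  then show ?thesis using ord by (rule landau_o.big_trans)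
qed

lemma not_nonpos_Reals_if_Re_nonneg:
  "Re w \<ge> 0 \<Longrightarrow> w \<noteq> 0 \<Longrightarrow> w \<notin> \<real>\<^sub>\<le>\<^sub>0"
  by (auto simp: complex_nonpos_Reals_iff complex_eq_iff)

text \<open>For \<beta> < 1 the quotient of the left side by t tends to infinity. Against the linear
  decay of a holomorphic function at a zero, this excludes a touching point at the vertex of the
  sector.\<close>

lemma powr_not_eventually_le_linear:
  fixes \<beta> C :: real
  assumes "0 < \<beta>" "\<beta> < 1"
  shows "\<not> (\<forall>\<^sub>F t in at_right 0. (t / 2) powr \<beta> \<le> C * t)"
proof
  assume "\<forall>\<^sub>F t in at_right 0. (t / 2) powr \<beta> \<le> C * t"
  moreover have "filterlim (\<lambda>t::real. (t / 2) powr \<beta> / t) at_top (at_right 0)"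
    using assms by real_asymp
  then have "\<forall>\<^sub>F t in at_right 0. C < (t / 2) powr \<beta> / t"
    by (simp add: filterlim_at_top_dense)
  moreover have "\<forall>\<^sub>F t in at_right (0::real). 0 < t"
    by (rule eventually_at_right_less)
  ultimately have "\<forall>\<^sub>F t in at_right (0::real). False"
    by eventually_elim (simp add: field_simps)
  then show False by simp
qed

lemma holomorphic_zero_radial_linear_bound:
  assumes "p holomorphic_on S" "open S" "z0 \<in> S" "p z0 = 0"
  obtains C where "\<forall>\<^sub>F t in at_right 0. norm (p (of_real (1 - t) * z0)) \<le> C * t"
proof -
  have "(p has_field_derivative deriv p z0) (at z0)"
    using assms by (simp add: holomorphic_derivI)
  then have "(\<lambda>t. p (of_real (1 - t) * z0) - p z0) \<in> O[at_right 0](\<lambda>t::real. complex_of_real t)"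
  proof (rule bigo_diff_compose)
    have "((\<lambda>t. complex_of_real (1 - t) * z0) \<longlongrightarrow> complex_of_real (1 - 0) * z0) (at_right 0)"
      by (intro tendsto_intros)
    then show "((\<lambda>t. complex_of_real (1 - t) * z0) \<longlongrightarrow> z0) (at_right 0)" by simp
    show "(\<lambda>t. complex_of_real (1 - t) * z0 - z0) \<in> O[at_right 0](complex_of_real)"
      by (rule bigoI[of _ "norm z0"]) (simp add: algebra_simps norm_mult)
  qed
  then obtain C where "\<forall>\<^sub>F t in at_right 0. norm (p (of_real (1 - t) * z0) - p z0) \<le> C * norm (complex_of_real t)"
    by (auto elim!: landau_o.bigE)
  then have "\<forall>\<^sub>F t in at_right 0. norm (p (of_real (1 - t) * z0)) \<le> C * t"
    using eventually_at_right_less[of 0] by eventually_elim (use assms in simp)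
  then show thesis by (rule that)
qed

section \<open>First exit from a sector\<close>

text \<open>\<open>z0\<close> is a point of least modulus at which \<open>p\<close> is outside the
  open sector. The power 1/\<beta> opens the sector to the right half-plane, where the boundary
  Schwarz lemma applies. Exit through the vertex 0 must be excluded: for \<beta> < 1 a zero decays
  too fast, whereas for \<beta> = 1 it can happen (\<open>1 - 2 * z\<close> with n = 1), so there
  zeros are ruled out by assumption.\<close>

lemma sector_touching_point:
  fixes p :: "complex \<Rightarrow> complex" and \<beta> :: real
  assumes hol: "p holomorphic_on ball 0 1" and p0: "p 0 = 1" 
    and ord: "(\<lambda>z. p z - 1) \<in> O[at 0](\<lambda>z. z ^ n)" and n: "n \<ge> 1"
    and \<beta>: "0 < \<beta>" "\<beta> \<le> 1" and nz: "\<beta> < 1 \<or> (\<forall>z\<in>ball 0 1. p z \<noteq> 0)"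
    and bad: "z1 \<in> ball 0 1" "\<not> (p z1 \<noteq> 0 \<and> \<bar>Arg (p z1)\<bar> < pi / 2 * \<beta>)"
  obtains z0 \<sigma> \<kappa> where "z0 \<in> ball 0 1" "z0 \<noteq> 0" "\<sigma> = 1 \<or> \<sigma> = -1" "p z0 \<noteq> 0"
    "Arg (p z0) = \<sigma> * (pi / 2 * \<beta>)" "z0 * deriv p z0 = \<i> * of_real (\<sigma> * \<kappa>) * p z0"
    "\<kappa> \<ge> n * \<beta> * (norm (p z0) powr (1 / \<beta>) + 1 / norm (p z0) powr (1 / \<beta>)) / 2"
proof -
  define c where "c = pi / 2 * \<beta>"
  have c: "0 < c" "c \<le> pi / 2" "c < pi" using \<beta> pi_gt_zero by (auto simp: c_def intro: le_less_trans[of _ "pi / 2"])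
  \<comment> \<open>Removing the slit makes \<open>Arg\<close> continuous, hence \<open>V\<close>
    open. It also removes 0, where \<open>Arg\<close> has the default value 0.\<close>
  define V where "V = {w \<in> - \<real>\<^sub>\<le>\<^sub>0. Arg w \<in> {-c<..<c}}"
  have V_iff: "w \<in> V \<longleftrightarrow> w \<noteq> 0 \<and> \<bar>Arg w\<bar> < c" for w
  proof
    assume w: "w \<noteq> 0 \<and> \<bar>Arg w\<bar> < c"
    then have "Re w > 0" using c Arg_Re_pos[of w] by linarith
    then show "w \<in> V" using w not_nonpos_Reals_if_Re_nonneg[of w] by (auto simp: V_def)
  qed (auto simp: V_def)
  have V_Re: "Re w > 0" if "w \<in> V" for w
    using that c Arg_Re_pos[of w] by (auto simp: V_iff)
  have "open V"
  proof -
    have "open (- \<real>\<^sub>\<le>\<^sub>0 \<inter> Arg -` {-c<..<c})"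
      by (rule continuous_open_preimage)
        (auto intro!: continuous_at_imp_continuous_on continuous_at_Arg simp: open_Compl)
    moreover have "V = - \<real>\<^sub>\<le>\<^sub>0 \<inter> Arg -` {-c<..<c}" by (auto simp: V_def)
    ultimately show ?thesis by simp
  qed
  have contp: "continuous_on (ball 0 1) p" by (rule holomorphic_on_imp_continuous_on[OF hol])
  define K where "K = cball 0 (norm z1) \<inter> p -` (- V)"
  have "continuous_on (cball 0 (norm z1)) p"
    by (rule continuous_on_subset[OF contp]) (use bad in auto)
  then have "closed K" unfolding K_def
    by (rule continuous_closed_preimage) (use \<open>open V\<close> in auto)
  then have "compact K" unfolding K_def by (metis Int_absorb1 compact_Int_closed compact_cball inf_le1)
  moreover have "z1 \<in> K" using bad V_iff by (auto simp: K_def c_def)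
  ultimately obtain z0 where z0K: "z0 \<in> K" and min: "\<And>z. z \<in> K \<Longrightarrow> norm z0 \<le> norm z"
    using continuous_attains_inf[of K norm] by (auto intro: continuous_intros)
  define r where "r = norm z0"
  have inV: "p z \<in> V" if "norm z < r" for z
    using that min[of z] z0K by (auto simp: K_def r_def)
  have z0b: "z0 \<in> ball 0 1" using z0K bad by (auto simp: K_def)
  have "z0 \<noteq> 0" using z0K p0 c by (auto simp: K_def V_iff)
  then have r: "0 < r" "r < 1" using z0b by (auto simp: r_def)
  \<comment> \<open>\<open>S\<close> contains the disc of radius r and, as shown below,
    \<open>z0\<close>; other points of the circle may be mapped by \<open>p\<close> onto the
    slit.\<close>
  define S where "S = ball 0 1 \<inter> p -` (- \<real>\<^sub>\<le>\<^sub>0)"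
  have "open S" unfolding S_def by (rule continuous_open_preimage[OF contp]) (auto simp: open_Compl)
  have sub: "ball 0 r \<subseteq> S" using inV r by (auto simp: S_def V_def)
  define h where "h = (\<lambda>z. exp (Ln (p z) / of_real \<beta>))"
  have holh: "h holomorphic_on S" unfolding h_def
    by (intro holomorphic_intros holomorphic_on_subset[OF hol]) (use \<beta> in \<open>auto simp: S_def\<close>)
  have Re_h: "Re (h z) = exp (ln (norm (p z)) / \<beta>) * cos (Arg (p z) / \<beta>)" 
    and norm_h: "norm (h z) = exp (ln (norm (p z)) / \<beta>)"
    and Im_h: "Im (h z) = exp (ln (norm (p z)) / \<beta>) * sin (Arg (p z) / \<beta>)" if "p z \<noteq> 0" for z
    using that by (simp_all add: h_def Re_exp Im_exp Arg_def)
  have Re_h_pos: "Re (h z) > 0" if "z \<in> ball 0 r" for z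
  proof -
    have "p z \<noteq> 0" "\<bar>Arg (p z)\<bar> < pi / 2 * \<beta>" using inV[of z] that by (auto simp: V_iff c_def)
    then have "\<bar>Arg (p z) / \<beta>\<bar> < pi / 2" using \<beta> by (simp add: divide_simps)
    then have "- (pi / 2) < Arg (p z) / \<beta>" "Arg (p z) / \<beta> < pi / 2" by linarith+
    then have "cos (Arg (p z) / \<beta>) > 0" by (rule cos_gt_zero_pi)
    then show ?thesis using \<open>p z \<noteq> 0\<close> by (simp add: Re_h)
  qed
  have ord_h: "(\<lambda>z. h z - 1) \<in> O[at 0](\<lambda>z. z ^ n)"
  proof -
    have "((\<lambda>w. exp (Ln w / of_real \<beta>)) has_field_derivative 1 / of_real \<beta>) (at 1)"
      using \<beta> by (auto intro!: derivative_eq_intros)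
    moreover have "(p \<longlongrightarrow> 1) (at 0)"
      using contp p0 by (metis centre_in_ball continuous_on_eq_continuous_at isCont_def open_ball zero_less_one)
    ultimately have "(\<lambda>z. exp (Ln (p z) / of_real \<beta>) - exp (Ln 1 / of_real \<beta>)) \<in> O[at 0](\<lambda>z. z ^ n)"
      using ord by (rule bigo_diff_compose)
    then show ?thesis by (simp add: h_def)
  qed
  \<comment> \<open>Along the radius to \<open>z0\<close>, with h taken at
    \<open>(1 - t) * z0\<close>, Schwarz gives
    \<open>1 - |h| <= |h - 1| <= (1 - t) * (|h| + 1)\<close>. Thus \<open>|h| >= t / 2\<close> and
    \<open>|p|\<close> is at least \<open>(t / 2) powr \<beta>\<close>, too slow a decay for a zero
    of \<open>p\<close> when \<beta> < 1.\<close>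
  have pz0: "p z0 \<noteq> 0"
  proof
    assume "p z0 = 0"
    then have "\<beta> < 1" using nz z0b by auto
    obtain C where C: "\<forall>\<^sub>F t in at_right 0. norm (p (of_real (1 - t) * z0)) \<le> C * t"
      using holomorphic_zero_radial_linear_bound[OF hol open_ball z0b \<open>p z0 = 0\<close>] by blast
    have low: "(t / 2) powr \<beta> \<le> norm (p (of_real (1 - t) * z0))" if t: "0 < t" "t < 1" for t
    proof -
      let ?z = "of_real (1 - t) * z0"
      have nz: "norm ?z = (1 - t) * r" using t by (simp only: norm_mult norm_of_real r_def)
      then have zb: "?z \<in> ball 0 r" "?z \<noteq> 0" using t r \<open>z0 \<noteq> 0\<close> by auto
      have pz: "p ?z \<noteq> 0" using inV[of ?z] zb by (auto simp: V_iff)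
      have "norm (h ?z - 1) \<le> (norm ?z / r) ^ n * norm (h ?z + 1)"
        by (rule Schwarz_halfplane[OF holomorphic_on_subset[OF holh sub] Re_h_pos ord_h zb])
      also have "\<dots> \<le> (1 - t) * norm (h ?z + 1)"
        using nz r t n power_decreasing[of 1 n "1 - t"] by (intro mult_right_mono) auto
      also have "\<dots> \<le> (1 - t) * (norm (h ?z) + 1)"
        using t norm_triangle_ineq[of "h ?z" 1] by (intro mult_left_mono) auto
      finally have "1 - norm (h ?z) \<le> (1 - t) * (norm (h ?z) + 1)"
        using norm_triangle_ineq2[of 1 "h ?z"] by (simp add: norm_minus_commute)
      then have "t \<le> (2 - t) * norm (h ?z)" by (simp add: algebra_simps)
      also have "\<dots> \<le> 2 * norm (h ?z)" using t by (intro mult_right_mono) auto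
      finally have "(t / 2) powr \<beta> \<le> norm (h ?z) powr \<beta>"
        using t \<beta> by (intro powr_mono2) auto
      also have "\<dots> = norm (p ?z)" using pz \<beta> by (simp add: norm_h powr_def)
      finally show ?thesis .
    qed
    have "\<forall>\<^sub>F t in at_right (0::real). 0 < t \<and> t < 1"
      unfolding eventually_at_right_field by (rule exI[of _ 1]) auto
    with C have "\<forall>\<^sub>F t in at_right 0. (t / 2) powr \<beta> \<le> C * t"
      by eventually_elim (use low in force)
    then show False using powr_not_eventually_le_linear \<beta>(1) \<open>\<beta> < 1\<close> by blast
  qed
  have lim: "((\<lambda>t. p (of_real (1 - t) * z0)) \<longlongrightarrow> p z0) (at_right 0)"
  proof -
    have "isCont p z0" using contp z0b by (metis continuous_on_eq_continuous_at open_ball)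
    moreover have "((\<lambda>t. complex_of_real (1 - t) * z0) \<longlongrightarrow> complex_of_real (1 - 0) * z0) (at_right 0)"
      by (intro tendsto_intros)
    ultimately show ?thesis by (intro isCont_tendsto_compose[of z0 p]) auto
  qed
  have evV: "\<forall>\<^sub>F t in at_right 0. p (of_real (1 - t) * z0) \<in> V"
    unfolding eventually_at_right_field
    by (rule exI[of _ 1]) (use r in \<open>auto intro!: inV simp: norm_mult r_def simp del: of_real_diff\<close>)
  \<comment> \<open>Radial limits place \<open>p z0\<close> in the closed sector. Being nonzero and
    outside \<open>V\<close>, it lies on one of the two boundary rays; \<sigma> below records
    which.\<close>
  have "Re (p z0) \<ge> 0"
    by (rule tendsto_lowerbound[OF tendsto_Re[OF lim]])
      (use evV in \<open>auto elim!: eventually_mono intro!: less_imp_le[OF V_Re]\<close>)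
  then have slit: "p z0 \<notin> \<real>\<^sub>\<le>\<^sub>0" using pz0 by (rule not_nonpos_Reals_if_Re_nonneg)
  then have z0S: "z0 \<in> S" using z0b by (simp add: S_def)
  have "((\<lambda>t. \<bar>Arg (p (of_real (1 - t) * z0))\<bar>) \<longlongrightarrow> \<bar>Arg (p z0)\<bar>) (at_right 0)"
    by (intro tendsto_rabs isCont_tendsto_compose[OF _ lim] continuous_at_Arg slit)
  then have "\<bar>Arg (p z0)\<bar> \<le> c"
    by (rule tendsto_upperbound) (use evV in \<open>auto elim!: eventually_mono simp: V_iff intro!: less_imp_le\<close>)
  moreover have "\<bar>Arg (p z0)\<bar> \<ge> c" using z0K pz0 by (auto simp: K_def V_iff)
  ultimately have abs: "\<bar>Arg (p z0)\<bar> = c" by simp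
  define \<sigma> :: real where "\<sigma> = (if Arg (p z0) \<ge> 0 then 1 else -1)"
  have \<sigma>: "\<sigma> = 1 \<or> \<sigma> = -1" "Arg (p z0) = \<sigma> * (pi / 2 * \<beta>)"
    using abs by (auto simp: \<sigma>_def c_def)
  define a where "a = norm (p z0) powr (1 / \<beta>)"
  have a: "a > 0" "a = exp (ln (norm (p z0)) / \<beta>)" using pz0 by (auto simp: a_def powr_def)
  have Arg_h: "Arg (p z0) / \<beta> = \<sigma> * (pi / 2)" using \<sigma>(2) \<beta> by simp
  have "Re (h z0) = 0" "Im (h z0) = \<sigma> * a"
    unfolding Re_h[OF pz0] Im_h[OF pz0] Arg_h a(2) using \<sigma>(1) by auto
  then have hz0: "h z0 = \<i> * of_real (\<sigma> * a)"
    by (simp add: complex_eq_iff)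
  obtain \<rho> where \<rho>: "z0 * deriv h z0 = - of_real \<rho>" "\<rho> \<ge> n * (1 + (norm (h z0))\<^sup>2) / 2"
  proof (rule halfplane_boundary_derivative[OF holh \<open>open S\<close> _ z0S \<open>z0 \<noteq> 0\<close> _ _ ord_h])
    show "ball 0 (cmod z0) \<subseteq> S" using sub by (simp add: r_def)
    show "Re (h z) > 0" if "z \<in> ball 0 (cmod z0)" for z using that Re_h_pos by (simp add: r_def)
    show "Re (h z0) = 0" by (simp add: hz0)
  qed blast
  have "(p has_field_derivative deriv p z0) (at z0)"
    using hol z0b by (simp add: holomorphic_derivI)
  then have "(h has_field_derivative h z0 * (deriv p z0 / p z0 / of_real \<beta>)) (at z0)"
    unfolding h_def using \<beta>(1) by (auto intro!: derivative_eq_intros slit simp: field_simps)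
  then have dh: "deriv h z0 = h z0 * (deriv p z0 / p z0 / of_real \<beta>)" by (rule DERIV_imp_deriv)
  have "h z0 * (z0 * deriv p z0) = (z0 * deriv h z0) * of_real \<beta> * p z0"
    unfolding dh using pz0 \<beta>(1) by simp
  then have eq: "\<i> * of_real \<sigma> * of_real a * (z0 * deriv p z0) = - of_real \<rho> * of_real \<beta> * p z0"
    unfolding \<rho>(1) by (simp add: hz0 mult_ac)
  \<comment> \<open>The logarithmic derivative of h is that of \<open>p\<close> divided by \<beta>.
    With \<open>h z0 = \<i> * \<sigma> * a\<close> and \<open>z0 * deriv h z0 = - \<rho>\<close>,
    this gives \<open>z0 * deriv p z0 / p z0 = \<i> * \<sigma> * \<rho> * \<beta> /
    a\<close>.\<close>
  define \<kappa> where "\<kappa> = \<rho> * \<beta> / a"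
  show thesis
  proof (rule that[of z0 \<sigma> \<kappa>])
    have s2: "complex_of_real \<sigma> * of_real \<sigma> = 1" using \<sigma>(1) by auto
    have "of_real a * (z0 * deriv p z0) = - \<i> * of_real \<sigma> * (\<i> * of_real \<sigma> * of_real a * (z0 * deriv p z0))"
      using s2 by (simp add: algebra_simps)
    also have "\<dots> = \<i> * of_real \<sigma> * of_real \<rho> * of_real \<beta> * p z0" unfolding eq by simp
    finally show "z0 * deriv p z0 = \<i> * of_real (\<sigma> * \<kappa>) * p z0"
      using a(1) by (simp add: \<kappa>_def field_simps)
    have na: "norm (h z0) = a" using hz0 a \<sigma>(1) by (auto simp: norm_mult)
    have "n * \<beta> * (a + 1 / a) / 2 = n * (1 + a\<^sup>2) / 2 * (\<beta> / a)"
      using a(1) by (simp add: field_simps power2_eq_square)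
    also have "\<dots> \<le> \<rho> * (\<beta> / a)"
      using \<rho>(2) a(1) \<beta> unfolding na by (intro mult_right_mono) auto
    finally show "n * \<beta> * (norm (p z0) powr (1 / \<beta>) + 1 / norm (p z0) powr (1 / \<beta>)) / 2 \<le> \<kappa>"
      by (simp add: \<kappa>_def a_def)
  qed (use z0b \<open>z0 \<noteq> 0\<close> \<sigma> pz0 in auto)
qed

section \<open>Arguments at a touching point and the bounds for p and P\<close>

text \<open>The principal argument of a negative real is pi, so \<theta> = -pi agrees only in
  absolute value. This end point does occur: for \<mu> = 1 the touching argument below is exactly pi
  in absolute value.\<close>

lemma abs_Arg_rcis: "r > 0 \<Longrightarrow> \<bar>\<theta>\<bar> \<le> pi \<Longrightarrow> \<bar>Arg (rcis r \<theta>)\<bar> = \<bar>\<theta>\<bar>"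
proof (cases "\<theta> = - pi")
  case True
  moreover assume "r > 0"
  moreover have "rcis r (- pi) = of_real (- r)" by (simp add: complex_eq_iff)
  ultimately show ?thesis by (simp only: Arg_of_real) simp
qed (subst Arg_rcis, auto)

text \<open>Both factors have arguments of sign \<sigma>, which add up to at most pi in absolute
  value. The angle of the second factor is expressed through X / Y rather than Y / X because X may
  be 0.\<close>

lemma abs_Arg_mult_offset:
  fixes w :: complex and \<sigma> c X Y :: real
  assumes "w \<noteq> 0" "Arg w = \<sigma> * c" "\<sigma> = 1 \<or> \<sigma> = -1" "0 \<le> c" "c \<le> pi / 2" "0 \<le> X" "0 < Y"
  shows "\<bar>Arg (w * (of_real X + \<i> * of_real (\<sigma> * Y)))\<bar> = c + (pi / 2 - arctan (X / Y))"
proof -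
  define \<psi> where "\<psi> = pi / 2 - arctan (X / Y)"
  define R where "R = Y * sqrt (1 + (X / Y)\<^sup>2)"
  have pos: "sqrt (1 + (X / Y)\<^sup>2) > 0" by (simp add: add_pos_nonneg)
  have R: "R > 0" using pos assms by (simp add: R_def)
  have "cos \<psi> = X / R" "sin \<psi> = Y / R"
    using assms pos by (simp_all add: \<psi>_def R_def cos_diff sin_diff sin_arctan cos_arctan)
  then have "of_real X + \<i> * of_real (\<sigma> * Y) = rcis R (\<sigma> * \<psi>)"
    using assms(3) R by (auto simp: complex_eq_iff)
  moreover have "w = rcis (norm w) (\<sigma> * c)" using rcis_cmod_Arg[of w] assms(2) by simp
  ultimately have "w * (of_real X + \<i> * of_real (\<sigma> * Y)) = rcis (norm w * R) (\<sigma> * (c + \<psi>))"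
    by (metis rcis_mult distrib_left)
  moreover have "0 \<le> \<psi>" "\<psi> \<le> pi / 2"
    using assms arctan_ubound[of "X / Y"] by (auto simp: \<psi>_def)
  then have "\<bar>\<sigma> * (c + \<psi>)\<bar> = c + \<psi>" "\<bar>\<sigma> * (c + \<psi>)\<bar> \<le> pi" using assms(3-5) by auto
  ultimately show ?thesis using assms(1) R by (simp add: abs_Arg_rcis \<psi>_def)
qed

lemma add_inverse_ge_2: "(x::real) > 0 \<Longrightarrow> x + 1 / x \<ge> 2"
  using zero_le_power2[of "x - 1"] by (simp add: field_simps power2_eq_square)

text \<open>At a touching point \<open>p + z * p'\<close> equals
  \<open>p * (1 + \<i> * \<sigma> * \<kappa>)\<close>, and \<open>a + 1 / a >= 2\<close> gives
  \<kappa> \<ge> n\<beta>. The modulus of its argument is then at least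
  \<open>pi / 2 * \<beta> + arctan (n * \<beta>)\<close>, which is
  \<open>pi / 2 * \<alpha>\<close>.\<close>

lemma Arg_bound_of_derivative:
  fixes p :: "complex \<Rightarrow> complex" and \<alpha> \<beta> :: real
  assumes hol: "p holomorphic_on ball 0 1" and p0: "p 0 = 1" 
    and ord: "(\<lambda>z. p z - 1) \<in> O[at 0](\<lambda>z. z ^ n)" and n: "n \<ge> 1"
    and \<beta>: "0 < \<beta>" "\<beta> < 1" and \<alpha>: "\<alpha> = \<beta> + 2 / pi * arctan (real n * \<beta>)"
    and bound: "\<And>z. z \<in> ball 0 1 \<Longrightarrow> \<bar>Arg (p z + z * deriv p z)\<bar> < pi / 2 * \<alpha>"
    and z: "z \<in> ball 0 1"
  shows "p z \<noteq> 0 \<and> \<bar>Arg (p z)\<bar> < pi / 2 * \<beta>"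
proof (rule ccontr)
  assume "\<not> ?thesis"
  from sector_touching_point[OF hol p0 ord n \<beta>(1) less_imp_le[OF \<beta>(2)] disjI1[OF \<beta>(2)] z this]
  obtain z0 \<sigma> \<kappa> where z0: "z0 \<in> ball 0 1" "z0 \<noteq> 0" and \<sigma>: "\<sigma> = 1 \<or> \<sigma> = -1" and p: "p z0 \<noteq> 0"
    "Arg (p z0) = \<sigma> * (pi / 2 * \<beta>)" "z0 * deriv p z0 = \<i> * of_real (\<sigma> * \<kappa>) * p z0"
    and \<kappa>: "\<kappa> \<ge> n * \<beta> * (norm (p z0) powr (1 / \<beta>) + 1 / norm (p z0) powr (1 / \<beta>)) / 2"
    by blast
  have "n * \<beta> * 2 \<le> n * \<beta> * (norm (p z0) powr (1 / \<beta>) + 1 / norm (p z0) powr (1 / \<beta>))"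
    using \<beta> p(1) by (intro mult_left_mono add_inverse_ge_2) auto
  then have \<kappa>: "n * \<beta> \<le> \<kappa>" using \<kappa> by simp
  moreover have "0 < n * \<beta>" using n \<beta> by simp
  ultimately have "\<kappa> > 0" by linarith
  have "p z0 + z0 * deriv p z0 = p z0 * (of_real 1 + \<i> * of_real (\<sigma> * \<kappa>))"
    unfolding p(3) by (simp add: algebra_simps)
  moreover have "\<bar>Arg (p z0 * (of_real 1 + \<i> * of_real (\<sigma> * \<kappa>)))\<bar> = pi / 2 * \<beta> + (pi / 2 - arctan (1 / \<kappa>))"
    by (rule abs_Arg_mult_offset) (use p \<sigma> \<beta> \<open>\<kappa> > 0\<close> in auto)
  moreover have "pi / 2 - arctan (1 / \<kappa>) = arctan \<kappa>"
    using arctan_inverse[OF \<open>\<kappa> > 0\<close>] by (simp add: inverse_eq_divide)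
  ultimately have "pi / 2 * \<beta> + arctan \<kappa> < pi / 2 * \<alpha>"
    using bound[OF z0(1)] by simp
  moreover have "pi / 2 * \<alpha> = pi / 2 * \<beta> + arctan (n * \<beta>)" by (simp add: \<alpha> field_simps)
  moreover have "arctan (n * \<beta>) \<le> arctan \<kappa>" using \<kappa> by (simp add: arctan_le_iff)
  ultimately show False by linarith
qed

section \<open>The constant in phi and the bound for the quotient q\<close>

text \<open>The bound is attained at \<open>a\<^sup>2 = (1 + \<mu>) / (1 - \<mu>)\<close>; this is where the constant in \<^const>\<open>phi\<close> comes from.\<close>
lemma phi_constant_bound:
  fixes a \<mu> :: real
  assumes "0 < a" "0 < \<mu>" "\<mu> < 1"
  shows "1 / (1 - \<mu>) * ((1 - \<mu>) / (1 + \<mu>)) powr ((1 + \<mu>) / 2) \<le> (a + 1 / a) / 2 / a powr \<mu>"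
proof -
  define l where "l = (1 + \<mu>) / 2"
  have l: "0 < l" "l < 1" and \<mu>: "\<mu> = 2 * l - 1" using assms by (auto simp: l_def field_simps)
  \<comment> \<open>Weighted arithmetic-geometric mean with weights l and 1 - l. The two numbers are
    chosen so that the weighted sum is \<open>a^2 + 1\<close>; equality holds when they coincide,
    that is at \<open>a^2 = l / (1 - l)\<close>.\<close>
  have "(a\<^sup>2 / l) powr l * (1 / (1 - l)) powr (1 - l) \<le> l * (a\<^sup>2 / l) + (1 - l) * (1 / (1 - l))"
    using l assms by (intro Youngs_inequality_0) auto
  also have "\<dots> = a\<^sup>2 + 1" using l by simp
  finally have young: "(a\<^sup>2 / l) powr l * (1 / (1 - l)) powr (1 - l) \<le> a\<^sup>2 + 1" .
  have apow: "(a\<^sup>2) powr l = a * a powr \<mu>"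
  proof -
    have "(a\<^sup>2) powr l = a powr (1 + \<mu>)"
      using assms by (simp add: powr_powr \<mu> flip: powr_numeral)
    then show ?thesis using assms by (simp add: powr_add)
  qed
  have "1 / (1 - \<mu>) * ((1 - \<mu>) / (1 + \<mu>)) powr ((1 + \<mu>) / 2) = 1 / (2 * (1 - l)) * ((1 - l) / l) powr l"
  proof -
    have "1 - \<mu> = 2 * (1 - l)" "1 + \<mu> = 2 * l" "(1 + \<mu>) / 2 = l" by (simp_all add: \<mu>)
    then show ?thesis by (simp only: mult_divide_mult_cancel_left_if) simp
  qed
  also have "\<dots> = 1 / 2 * (1 / l) powr l * (1 / (1 - l)) powr (1 - l)"
    using l by (simp add: powr_divide powr_diff field_simps)
  also have "\<dots> = (a\<^sup>2 / l) powr l * (1 / (1 - l)) powr (1 - l) / (2 * a * a powr \<mu>)"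
    using l assms by (simp add: powr_divide apow field_simps)
  also have "\<dots> \<le> (a\<^sup>2 + 1) / (2 * a * a powr \<mu>)"
    using young assms by (intro divide_right_mono) auto
  also have "\<dots> = (a + 1 / a) / 2 / a powr \<mu>"
    using assms by (simp add: field_simps power2_eq_square)
  finally show ?thesis .
qed

text \<open>The right side is the modulus of the argument of
  \<open>q * (q + \<i> * \<sigma> * \<kappa>)\<close> at a touching point with
  \<open>|q| = Q\<close>. Dividing by Q leaves \<open>cos c / (sin c + \<kappa> / Q)\<close>, and
  the preceding bound with \<open>a powr \<mu> = Q\<close> says that \<kappa> / Q is at least the
  constant \<open>E\<close> of \<open>phi\<close>.\<close>

lemma phi_le_touching_Arg:
  fixes Q \<kappa> \<mu> :: real
  assumes n: "n \<ge> 1" and \<mu>: "0 < \<mu>" "\<mu> \<le> 1" and Q: "0 < Q"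
    and \<kappa>: "\<kappa> \<ge> n * \<mu> * (Q powr (1 / \<mu>) + 1 / Q powr (1 / \<mu>)) / 2"
  defines "c \<equiv> pi / 2 * \<mu>"
  shows "phi n \<mu> \<le> c + (pi / 2 - arctan (Q * cos c / (Q * sin c + \<kappa>)))"
proof -
  define a where "a = Q powr (1 / \<mu>)"
  have a: "a > 0" "a powr \<mu> = Q" using Q \<mu> by (auto simp: a_def powr_powr)
  define E where "E = real n * \<mu> / (1 - \<mu>) * ((1 - \<mu>) / (1 + \<mu>)) powr ((1 + \<mu>) / 2)"
  have c': "\<mu> * pi / 2 = c" by (simp add: c_def)
  \<comment> \<open>For \<mu> = 1 the term \<open>E\<close> contains a division by zero, with value
    0, but \<open>cos c = 0\<close> makes both sides vanish.\<close>
  have "arctan (Q * cos c / (Q * sin c + \<kappa>)) \<le> arctan (cos c / (sin c + E))"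
  proof (cases "\<mu> = 1")
    case True
    then show ?thesis by (simp add: c_def)
  next
    case False
    then have \<mu>1: "\<mu> < 1" using \<mu> by simp
    have c: "0 < c" "c < pi / 2" using \<mu> \<mu>1 pi_gt_zero by (auto simp: c_def)
    then have sc: "cos c > 0" "sin c > 0" by (auto intro: cos_gt_zero sin_gt_zero2)
    have "E \<ge> 0" using \<mu> \<mu>1 by (simp add: E_def)
    have "E = n * \<mu> * (1 / (1 - \<mu>) * ((1 - \<mu>) / (1 + \<mu>)) powr ((1 + \<mu>) / 2))" by (simp add: E_def)
    also have "\<dots> \<le> n * \<mu> * ((a + 1 / a) / 2 / a powr \<mu>)"
      using \<mu> by (intro mult_left_mono phi_constant_bound a \<mu>1) auto
    also have "\<dots> = n * \<mu> * (a + 1 / a) / 2 / Q" by (simp add: a(2))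
    also have "\<dots> \<le> \<kappa> / Q" using \<kappa> Q unfolding a_def by (intro divide_right_mono) auto
    finally have E\<kappa>: "E \<le> \<kappa> / Q" .
    have "Q * cos c / (Q * sin c + \<kappa>) = cos c / (sin c + \<kappa> / Q)"
      using Q by (simp add: field_simps)
    also have "\<dots> \<le> cos c / (sin c + E)"
      using sc \<open>E \<ge> 0\<close> E\<kappa> by (intro divide_left_mono mult_pos_pos) auto
    finally show ?thesis by (simp add: arctan_le_iff)
  qed
  then show ?thesis
    unfolding phi_def c' E_def[symmetric] by (simp add: c_def field_simps)
qed

text \<open>If \<open>q = p / P\<close> reached the sector boundary, then
  \<open>(p + z * p') / P = q * (q + z * q' / q)\<close> would have an argument of modulus at least
  \<open>phi n \<mu>\<close>. The bounds \<alpha> for the numerator and \<gamma> for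
  \<open>P\<close> make it strictly smaller.\<close>

lemma quotient_strongly_starlike:
  fixes p P :: "complex \<Rightarrow> complex" and \<alpha> \<gamma> \<mu> :: real
  assumes hol: "p holomorphic_on ball 0 1" "P holomorphic_on ball 0 1" and at0: "p 0 = 1" "P 0 = 1" 
    and ord: "(\<lambda>z. p z - 1) \<in> O[at 0](\<lambda>z. z ^ n)" "(\<lambda>z. P z - 1) \<in> O[at 0](\<lambda>z. z ^ n)" and n: "n \<ge> 1"
    and \<mu>: "0 < \<mu>" "\<mu> \<le> 1" and nz: "\<And>z. z \<in> ball 0 1 \<Longrightarrow> p z \<noteq> 0" "\<And>z. z \<in> ball 0 1 \<Longrightarrow> P z \<noteq> 0"
    and eq: "\<And>z. z \<in> ball 0 1 \<Longrightarrow> P z + z * deriv P z = p z"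
    and bound: "\<And>z. z \<in> ball 0 1 \<Longrightarrow> p z + z * deriv p z \<noteq> 0"
      "\<And>z. z \<in> ball 0 1 \<Longrightarrow> \<bar>Arg (p z + z * deriv p z)\<bar> < pi / 2 * \<alpha>"
      "\<And>z. z \<in> ball 0 1 \<Longrightarrow> \<bar>Arg (P z)\<bar> < pi / 2 * \<gamma>"
    and phi: "pi / 2 * (\<alpha> + \<gamma>) \<le> phi n \<mu>" "phi n \<mu> \<le> pi"
    and z: "z \<in> ball 0 1"
  shows "\<bar>Arg (p z / P z)\<bar> < pi / 2 * \<mu>"
proof (rule ccontr)
  assume bad: "\<not> ?thesis"
  define q where "q = (\<lambda>z. p z / P z)"
  have holq: "q holomorphic_on ball 0 1" unfolding q_def using hol nz by (intro holomorphic_intros) auto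
  \<comment> \<open>\<open>q - 1\<close> is \<open>(p - 1) - (P - 1)\<close> divided by
    \<open>P\<close>, and \<open>1 / P\<close> is bounded near 0.\<close>
  have ordq: "(\<lambda>z. q z - 1) \<in> O[at 0](\<lambda>z. z ^ n)"
  proof -
    have "isCont P 0" using hol(2)
      by (metis centre_in_ball continuous_on_eq_continuous_at holomorphic_on_imp_continuous_on open_ball zero_less_one)
    then have "((\<lambda>z. 1 / P z) \<longlongrightarrow> 1) (at 0)"
      using tendsto_divide[OF tendsto_const, of P 1 "at 0" 1] at0 by (simp add: isCont_def)
    then have "(\<lambda>z. 1 / P z) \<in> O[at 0](\<lambda>_. 1)"
      by (intro bigoI_tendsto[of _ _ 1]) auto
    then have "(\<lambda>z. (1 / P z) * ((p z - 1) - (P z - 1))) \<in> O[at 0](\<lambda>z. 1 * z ^ n)"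
      by (rule landau_o.big.mult) (intro sum_in_bigo ord)
    moreover have "\<forall>\<^sub>F z in at 0. z \<in> ball (0::complex) 1"
      by (intro eventually_at_in_open') auto
    then have "\<forall>\<^sub>F z in at (0::complex). 1 / P z * (p z - 1 - (P z - 1)) = q z - 1"
      by eventually_elim (use nz in \<open>simp add: q_def field_simps\<close>)
    note landau_o.big.in_cong[OF this]
    ultimately show ?thesis by simp
  qed
  have q: "q 0 = 1" "\<forall>z\<in>ball 0 1. q z \<noteq> 0" "\<not> (q z \<noteq> 0 \<and> \<bar>Arg (q z)\<bar> < pi / 2 * \<mu>)"
    using at0 nz bad by (auto simp: q_def)
  from sector_touching_point[OF holq q(1) ordq n \<mu> disjI2[OF q(2)] z q(3)]
  obtain z0 \<sigma> \<kappa> where z0: "z0 \<in> ball 0 1" "z0 \<noteq> 0" and \<sigma>: "\<sigma> = 1 \<or> \<sigma> = -1" and qz: "q z0 \<noteq> 0"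
    "Arg (q z0) = \<sigma> * (pi / 2 * \<mu>)" "z0 * deriv q z0 = \<i> * of_real (\<sigma> * \<kappa>) * q z0"
    and \<kappa>: "\<kappa> \<ge> n * \<mu> * (norm (q z0) powr (1 / \<mu>) + 1 / norm (q z0) powr (1 / \<mu>)) / 2"
    by blast
  define Q where "Q = norm (q z0)"
  define c where "c = pi / 2 * \<mu>"
  have Q: "Q > 0" using qz by (simp add: Q_def)
  have c: "0 < c" "c \<le> pi / 2" using \<mu> by (auto simp: c_def)
  have sc: "cos c \<ge> 0" "sin c > 0" using c by (auto intro: cos_ge_zero sin_gt_zero)
  have "0 < n * \<mu> * (Q powr (1 / \<mu>) + 1 / Q powr (1 / \<mu>)) / 2"
    using n \<mu> Q by (intro divide_pos_pos mult_pos_pos add_pos_pos) auto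
  then have "\<kappa> > 0" using \<kappa> unfolding Q_def by linarith
  have P0: "P z0 \<noteq> 0" using nz z0 by auto
  have dq: "deriv q z0 = (deriv p z0 * P z0 - p z0 * deriv P z0) / (P z0 * P z0)"
    unfolding q_def
    by (rule DERIV_imp_deriv, rule DERIV_divide) (use hol z0 P0 in \<open>auto intro: holomorphic_derivI\<close>)
  have "deriv q z0 * P z0 = deriv p z0 - q z0 * deriv P z0"
    unfolding dq using P0 by (simp add: q_def field_simps)
  then have "z0 * (deriv q z0 * P z0) = z0 * (deriv p z0 - q z0 * deriv P z0)" by simp
  then have "z0 * deriv q z0 * P z0 = z0 * deriv p z0 - q z0 * (z0 * deriv P z0)"
    by (simp add: algebra_simps)
  moreover have "p z0 = q z0 * P z0" using P0 by (simp add: q_def)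
  moreover have "z0 * deriv P z0 = p z0 - P z0" using eq[OF z0(1)] by (simp add: algebra_simps)
  \<comment> \<open>Differentiating \<open>p = q * P\<close> and replacing
    \<open>z0 * deriv P z0\<close> by \<open>p z0 - P z0\<close> makes the terms
    \<open>q z0 * P z0\<close> cancel.\<close>
  ultimately have eq': "p z0 + z0 * deriv p z0 = P z0 * (q z0 * (q z0 + \<i> * of_real (\<sigma> * \<kappa>)))"
    unfolding qz(3) by (simp add: algebra_simps)
  have "q z0 = rcis Q (\<sigma> * c)" using rcis_cmod_Arg[of "q z0"] qz(2) by (simp add: Q_def c_def)
  then have "q z0 + \<i> * of_real (\<sigma> * \<kappa>) = of_real (Q * cos c) + \<i> * of_real (\<sigma> * (Q * sin c + \<kappa>))"
    using \<sigma> by (auto simp: complex_eq_iff algebra_simps)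
  then have "\<bar>Arg (q z0 * (q z0 + \<i> * of_real (\<sigma> * \<kappa>)))\<bar> 
      = c + (pi / 2 - arctan (Q * cos c / (Q * sin c + \<kappa>)))"
    using abs_Arg_mult_offset[of "q z0" \<sigma> c "Q * cos c" "Q * sin c + \<kappa>"] qz \<sigma> c sc Q \<open>\<kappa> > 0\<close>
    by (simp add: c_def add_pos_pos)
  also have "\<dots> \<ge> phi n \<mu>"
    unfolding c_def by (rule phi_le_touching_Arg) (use n \<mu> Q \<kappa> in \<open>auto simp: Q_def\<close>)
  finally have ge: "phi n \<mu> \<le> \<bar>Arg (q z0 * (q z0 + \<i> * of_real (\<sigma> * \<kappa>)))\<bar>" .
  have "q z0 * (q z0 + \<i> * of_real (\<sigma> * \<kappa>)) = (p z0 + z0 * deriv p z0) / P z0"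
    unfolding eq' using P0 by simp
  \<comment> \<open>Since \<open>phi n \<mu>\<close> is at most pi, this strict bound keeps the
    difference of the principal arguments inside (-pi, pi), so it is the principal argument of the
    quotient.\<close>
  moreover have lt: "\<bar>Arg (p z0 + z0 * deriv p z0) - Arg (P z0)\<bar> < phi n \<mu>"
    using bound(2,3)[OF z0(1)] phi(1) by (simp add: distrib_left)
  then have "Arg ((p z0 + z0 * deriv p z0) / P z0) = Arg (p z0 + z0 * deriv p z0) - Arg (P z0)"
    using phi(2) by (subst Arg_divide'[OF bound(1)[OF z0(1)] P0]) auto
  ultimately show False using ge lt by simp
qed

section \<open>Taylor coefficients, division by z, and the integral transform\<close>

text \<open>Taylor's formula of degree n - 1 at 0: the polynomial vanishes and only the remainder of
  order n is left.\<close>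

lemma bigo_power_if_higher_deriv_0:
  fixes g :: "complex \<Rightarrow> complex"
  assumes hol: "g holomorphic_on S" and S: "open S" "0 \<in> S" and n: "n \<ge> 1"
    and zero: "\<And>k. k < n \<Longrightarrow> (deriv ^^ k) g 0 = 0"
  shows "g \<in> O[at 0](\<lambda>z. z ^ n)"
proof -
  obtain m where m: "n = Suc m" using n by (cases n) auto
  obtain e where e: "e > 0" "cball 0 e \<subseteq> S" using S by (meson open_contains_cball)
  have d: "((deriv ^^ i) g has_field_derivative (deriv ^^ Suc i) g x) (at x within cball 0 e)"
    if "x \<in> cball 0 e" for i x
  proof -
    have "(deriv ^^ i) g holomorphic_on S" using hol S(1) by (rule holomorphic_higher_deriv)
    then have "((deriv ^^ i) g has_field_derivative deriv ((deriv ^^ i) g) x) (at x)"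
      by (rule holomorphic_derivI) (use that e S in auto)
    then show ?thesis unfolding funpow.simps o_apply by (rule has_field_derivative_at_within)
  qed
  have "continuous_on (cball 0 e) ((deriv ^^ Suc m) g)"
    using holomorphic_higher_deriv[OF hol S(1)] e(2)
    by (rule continuous_on_subset[OF holomorphic_on_imp_continuous_on])
  then have "compact ((deriv ^^ Suc m) g ` cball 0 e)"
    by (rule compact_continuous_image) simp
  then have "bounded ((deriv ^^ Suc m) g ` cball 0 e)" by (rule compact_imp_bounded)
  then obtain B where B: "\<And>x. x \<in> cball 0 e \<Longrightarrow> norm ((deriv ^^ Suc m) g x) \<le> B"
    unfolding bounded_iff by blast
  have bd: "norm (g z) \<le> B / fact m * norm (z ^ n)" if z: "z \<in> ball 0 e" for z
  proof -
    have "norm ((deriv ^^ 0) g z - (\<Sum>i\<le>m. (deriv ^^ i) g 0 * (z - 0) ^ i / fact i)) \<le> B * norm (z - 0) ^ Suc m / fact m"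
    proof (rule complex_Taylor[where f = "\<lambda>i. (deriv ^^ i) g" and S = "cball 0 e"])
      show "((deriv ^^ i) g has_field_derivative (deriv ^^ Suc i) g x) (at x within cball 0 e)"
        if "x \<in> cball 0 e" for i x by (rule d[OF that])
      show "norm ((deriv ^^ Suc m) g x) \<le> B" if "x \<in> cball 0 e" for x by (rule B[OF that])
    qed (use e z in auto)
    moreover have "(\<Sum>i\<le>m. (deriv ^^ i) g 0 * (z - 0) ^ i / fact i) = 0"
    proof (intro sum.neutral ballI)
      fix i assume "i \<in> {..m}"
      then have "(deriv ^^ i) g 0 = 0" by (intro zero) (simp add: m)
      then show "(deriv ^^ i) g 0 * (z - 0) ^ i / fact i = 0" by simp
    qed
    ultimately have "norm (g z) \<le> B * norm z ^ Suc m / fact m" by (simp only: diff_zero funpow_0)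
    then show ?thesis by (simp only: m norm_power) simp
  qed
  have "\<forall>\<^sub>F z in at 0. z \<in> ball (0::complex) e"
    by (intro eventually_at_in_open') (use e in auto)
  then have "\<forall>\<^sub>F z in at 0. norm (g z) \<le> B / fact m * norm (z ^ n)"
    by eventually_elim (rule bd)
  then show ?thesis by (rule bigoI)
qed

text \<open>The value 1 at the origin is the derivative at 0 of a normalised f, so it fills the
  removable singularity of f / z.\<close>

definition div_id :: "(complex \<Rightarrow> complex) \<Rightarrow> complex \<Rightarrow> complex" where
  "div_id f z = (if z = 0 then 1 else f z / z)"

text \<open>Everything comes from writing f as z times \<open>div_id f\<close>. In the Leibniz
  formula at 0 only the first derivative of the identity survives, hence the factor k + 1 and the
  index shift: vanishing of the derivatives 2 to n of f means vanishing of the derivatives 1 to n -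
  1 of \<open>div_id f\<close>.\<close>

lemma
  assumes f: "class_A n f" and n: "n \<ge> 1"
  shows div_id_holomorphic: "div_id f holomorphic_on ball 0 1"
    and div_id_order: "(\<lambda>z. div_id f z - 1) \<in> O[at 0](\<lambda>z. z ^ n)"
    and higher_deriv_div_id: "(deriv ^^ Suc k) f 0 = of_nat (Suc k) * (deriv ^^ k) (div_id f) 0"
    and deriv_eq_div_id: "z \<in> ball 0 1 \<Longrightarrow> deriv f z = div_id f z + z * deriv (div_id f) z"
proof -
  have holf: "f holomorphic_on ball 0 1" and f0: "f 0 = 0" "deriv f 0 = 1"
    and fk: "\<And>k. 2 \<le> k \<Longrightarrow> k \<le> n \<Longrightarrow> (deriv ^^ k) f 0 = 0"
    using f by (auto simp: class_A_def)
  show hol: "div_id f holomorphic_on ball 0 1"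
    by (rule pole_theorem_open_0[where g = f and a = 0]) (use holf f0 in \<open>auto simp: div_id_def\<close>)
  have f_eq: "(\<lambda>w. w * div_id f w) = f" using f0 by (auto simp: div_id_def)
  show hd: "(deriv ^^ Suc k) f 0 = of_nat (Suc k) * (deriv ^^ k) (div_id f) 0" for k
  proof -
    let ?t = "\<lambda>i. of_nat (Suc k choose i) * (deriv ^^ i) (\<lambda>w. w) 0 * (deriv ^^ (Suc k - i)) (div_id f) 0"
    have "(deriv ^^ Suc k) (\<lambda>w. w * div_id f w) 0 = sum ?t {0..Suc k}"
      by (rule higher_deriv_mult[of _ "ball 0 1"]) (use hol in \<open>auto intro: holomorphic_intros\<close>)
    also have "\<dots> = sum ?t {1}"
      by (rule sum.mono_neutral_right) (simp_all add: higher_deriv_ident)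
    also have "\<dots> = of_nat (Suc k) * (deriv ^^ k) (div_id f) 0"
      by (simp add: higher_deriv_ident)
    finally show ?thesis unfolding f_eq .
  qed
  have "(deriv ^^ k) (\<lambda>z. div_id f z - 1) 0 = 0" if "k < n" for k
  proof -
    have "(deriv ^^ k) (\<lambda>z. div_id f z - 1) 0 = (deriv ^^ k) (div_id f) 0 - (deriv ^^ k) (\<lambda>_. 1) 0"
      by (rule higher_deriv_diff[of _ "ball 0 1"]) (use hol in auto)
    moreover have "of_nat (Suc k) * (deriv ^^ k) (div_id f) 0 = (if k = 0 then 1 else 0)"
      using hd[of k] fk[of "Suc k"] f0 that by (cases k) auto
    ultimately show ?thesis by (cases k) (simp_all add: div_id_def del: of_nat_Suc)
  qed
  then show "(\<lambda>z. div_id f z - 1) \<in> O[at 0](\<lambda>z. z ^ n)"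
    by (intro bigo_power_if_higher_deriv_0[of _ "ball 0 1"] n) (use hol in \<open>auto intro: holomorphic_intros\<close>)
  show "deriv f z = div_id f z + z * deriv (div_id f) z" if "z \<in> ball 0 1"
  proof -
    have "((\<lambda>w. w * div_id f w) has_field_derivative 1 * div_id f z + deriv (div_id f) z * z) (at z)"
      by (rule DERIV_mult) (use hol that in \<open>auto intro: holomorphic_derivI\<close>)
    then have "(f has_field_derivative 1 * div_id f z + deriv (div_id f) z * z) (at z)"
      unfolding f_eq .
    from DERIV_imp_deriv[OF this] show ?thesis by (simp add: mult.commute)
  qed
qed

text \<open>On the convex disc F is the primitive of \<open>div_id f\<close> vanishing at 0. Its
  derivative of order k + 1 at 0 is therefore that of f divided by k + 1, so the vanishing
  coefficients are inherited.\<close>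

lemma integral_transform_class_A:
  assumes f: "class_A n f" and n: "n \<ge> 1"
  defines "F \<equiv> \<lambda>z. contour_integral (linepath 0 z) (\<lambda>t. f t / t)"
  shows "class_A n F" and "z \<in> ball 0 1 \<Longrightarrow> deriv F z = div_id f z"
proof -
  note hol = div_id_holomorphic[OF f n]
  obtain G where G: "\<And>z. z \<in> ball 0 1 \<Longrightarrow> (G has_field_derivative div_id f z) (at z within ball 0 1)"
    using holomorphic_convex_primitive'[OF convex_ball open_ball hol] by blast
  have F_eq: "F z = G z - G 0" if z: "z \<in> ball 0 1" for z
  proof (cases "z = 0")
    case False
    \<comment> \<open>At t = 0 the integrand \<open>f t / t\<close> has the default value 0 instead
      of 1; changing it at one point leaves the integral alone.\<close>
    have "F z = contour_integral (linepath 0 z) (div_id f)"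
      unfolding F_def
      by (rule contour_integral_spike_finite_simple_path[of "{0}"]) (use False in \<open>auto simp: div_id_def\<close>)
    also have "\<dots> = G (pathfinish (linepath 0 z)) - G (pathstart (linepath 0 z))"
    proof (intro contour_integral_unique contour_integral_primitive[of "ball 0 1"] G)
      show "path_image (linepath 0 z) \<subseteq> ball 0 1"
        unfolding path_image_linepath by (rule closed_segment_subset) (use z in auto)
    qed (assumption | rule valid_path_linepath)+
    finally show ?thesis by simp
  qed (simp add: F_def)
  have dF: "(F has_field_derivative div_id f z) (at z)" if "z \<in> ball 0 1" for z
  proof (rule has_field_derivative_transform_within_open[of "\<lambda>z. G z - G 0" _ _ "ball 0 1"])
    show "((\<lambda>z. G z - G 0) has_field_derivative div_id f z) (at z)"
      using G[OF that] at_within_open[OF that open_ball] by (auto intro!: derivative_eq_intros)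
  qed (use that F_eq in auto)
  show deriv: "deriv F z = div_id f z" if "z \<in> ball 0 1" for z
    using dF[OF that] by (rule DERIV_imp_deriv)
  have hd: "(deriv ^^ Suc k) F 0 = (deriv ^^ k) (div_id f) 0" for k
  proof -
    have "\<forall>\<^sub>F z in nhds 0. deriv F z = div_id f z"
      using eventually_nhds_in_open[of "ball 0 1" "0::complex"] deriv by (auto elim!: eventually_mono)
    then show ?thesis unfolding funpow_Suc_right o_def by (rule higher_deriv_cong_ev) simp
  qed
  show "class_A n F" unfolding class_A_def
  proof (intro conjI allI impI)
    show "F holomorphic_on ball 0 1"
      unfolding holomorphic_on_open[OF open_ball] using dF by blast
    show "F 0 = 0" by (simp add: F_def)
    show "deriv F 0 = 1" by (simp add: deriv div_id_def)
    show "(deriv ^^ k) F 0 = 0" if k: "2 \<le> k \<and> k \<le> n" for k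
    proof -
      obtain j where j: "k = Suc j" using k by (cases k) auto
      have "of_nat (Suc j) * (deriv ^^ j) (div_id f) 0 = 0"
        using higher_deriv_div_id[OF f n, of j] f k unfolding class_A_def j by metis
      then show ?thesis unfolding j hd by (simp del: of_nat_Suc)
    qed
  qed
qed

section \<open>Assembling the three sector bounds\<close>

lemma phi_upper_bound:
  assumes "0 < \<mu>" "\<mu> \<le> 1"
  shows "phi n \<mu> \<le> pi / 2 * (\<mu> + 1)"
proof -
  have "\<mu> * pi / 2 \<le> pi / 2" "0 < \<mu> * pi / 2" using assms by auto
  then have "cos (\<mu> * pi / 2) \<ge> 0" "sin (\<mu> * pi / 2) \<ge> 0"
    using pi_gt_zero by (intro cos_ge_zero sin_ge_zero; linarith)+
  then have "0 \<le> cos (\<mu> * pi / 2) / (sin (\<mu> * pi / 2) + real n * \<mu> / (1 - \<mu>) * ((1 - \<mu>) / (1 + \<mu>)) powr ((1 + \<mu>) / 2))"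
    using assms by (intro divide_nonneg_nonneg add_nonneg_nonneg mult_nonneg_nonneg) auto
  then show ?thesis by (simp add: phi_def)
qed

theorem theorem2:
  fixes n :: nat and \<alpha> \<beta> \<gamma> \<mu> :: real and f :: "complex \<Rightarrow> complex"
  assumes "n \<ge> 1"
    and "\<alpha> > 0" and "\<gamma> > 0" and "0 < \<mu>" and "\<mu> \<le> 1"
    and "\<alpha> = \<beta> + 2 / pi * arctan (real n * \<beta>)"
    and "\<beta> = \<gamma> + 2 / pi * arctan (real n * \<gamma>)"
    and "pi / 2 * (\<alpha> + \<gamma>) \<le> phi n \<mu>"
    and "class_A n f"
    and "\<forall>z\<in>ball 0 1. deriv f z \<noteq> 0 \<and> \<bar>Arg (deriv f z)\<bar> < pi / 2 * \<alpha>"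
  shows "STS n \<mu> (\<lambda>z. contour_integral (linepath 0 z) (\<lambda>t. f t / t))"
proof -
  define F where "F = (\<lambda>z. contour_integral (linepath 0 z) (\<lambda>t. f t / t))"
  note n = \<open>n \<ge> 1\<close> and f = \<open>class_A n f\<close> and \<mu> = \<open>0 < \<mu>\<close> \<open>\<mu> \<le> 1\<close>
  note F = integral_transform_class_A[OF f n, folded F_def]
  define p where "p = div_id f"
  define P where "P = div_id F"
  have at0: "p 0 = 1" "P 0 = 1" by (simp_all add: p_def P_def div_id_def)
  note p = div_id_holomorphic[OF f n, folded p_def] div_id_order[OF f n, folded p_def]
    deriv_eq_div_id[OF f n, folded p_def]
  note P = div_id_holomorphic[OF F(1) n, folded P_def] div_id_order[OF F(1) n, folded P_def]
    deriv_eq_div_id[OF F(1) n, folded P_def]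
  have dF: "deriv F z = p z" if "z \<in> ball 0 1" for z using F(2) that by (simp add: p_def)
  have phi: "phi n \<mu> \<le> pi / 2 * (\<mu> + 1)" using \<mu> by (rule phi_upper_bound)
  also have "\<dots> \<le> pi" using \<mu> by (simp add: field_simps)
  finally have phi_pi: "phi n \<mu> \<le> pi" .
  have gb: "\<gamma> < \<beta>" using assms(1,3,7) by simp
  \<comment> \<open>By the two defining relations this says \<beta> - \<gamma> < \<alpha> - \<beta>;
    with \<alpha> + \<gamma> \<le> 2 it yields \<beta> < 1, so the vertex is excluded in both
    applications of the derivative bound.\<close>
  have "2 / pi * arctan (real n * \<gamma>) < 2 / pi * arctan (real n * \<beta>)"
    using gb n by (intro mult_strict_left_mono) (auto simp: arctan_less_iff)
  then have "2 * \<beta> < \<alpha> + \<gamma>" using assms(6,7) by linarith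
  moreover have "\<alpha> + \<gamma> \<le> 2"
  proof -
    have "pi / 2 * (\<alpha> + \<gamma>) \<le> pi / 2 * 2" using assms(8) phi_pi by linarith
    then show ?thesis by (rule mult_left_le_imp_le) simp
  qed
  ultimately have \<beta>: "\<beta> < 1" by linarith
  have argp: "p z \<noteq> 0 \<and> \<bar>Arg (p z)\<bar> < pi / 2 * \<beta>" if "z \<in> ball 0 1" for z
    by (rule Arg_bound_of_derivative[OF p(1) at0(1) p(2) n _ \<beta> assms(6) _ that])
      (use assms(3,10) gb p(3) in auto)
  \<comment> \<open>The same descent one level down: \<open>p\<close> is \<open>P + z * P'\<close>,
    and \<beta> arises from \<gamma> as \<alpha> does from \<beta>.\<close>
  have argP: "P z \<noteq> 0 \<and> \<bar>Arg (P z)\<bar> < pi / 2 * \<gamma>" if "z \<in> ball 0 1" for z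
    by (rule Arg_bound_of_derivative[OF P(1) at0(2) P(2) n assms(3) _ assms(7) _ that])
      (use argp gb \<beta> P(3) dF in force)+
  have "z * deriv F z / F z \<noteq> 0 \<and> \<bar>Arg (z * deriv F z / F z)\<bar> < pi / 2 * \<mu>"
    if z: "z \<in> ball 0 1 - {0}" for z
  proof -
    have "F z = z * P z" "z \<noteq> 0" using z by (auto simp: P_def div_id_def)
    then have "z * deriv F z / F z = p z / P z" using z dF[of z] by simp
    moreover have "p z / P z \<noteq> 0" using argp[of z] argP[of z] z by simp
    moreover have "\<bar>Arg (p z / P z)\<bar> < pi / 2 * \<mu>"
    proof (rule quotient_strongly_starlike[OF p(1) P(1) at0 p(2) P(2) n \<mu>])
      show "P x + x * deriv P x = p x" if "x \<in> ball 0 1" for x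
        using P(3)[OF that] dF[OF that] by simp
      show "p x + x * deriv p x \<noteq> 0" "\<bar>Arg (p x + x * deriv p x)\<bar> < pi / 2 * \<alpha>"
        if "x \<in> ball 0 1" for x
        using assms(10)[rule_format, OF that] unfolding p(3)[OF that] by auto
    qed (use argp argP assms(8) phi_pi z in auto)
    ultimately show ?thesis by simp
  qed
  with F(1) show ?thesis by (simp add: STS_def F_def)
qed

end
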